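(* For any integer $b\geq 2$, \[AR_V(K_{2,b})=3b.\]
   Context: $K_{m,n}$ denotes the complete bipartite graph with parts of sizes $m$ and $n$. An edge-coloring (with any number of colors) is proper if no two adjacent edges (edges sharing a vertex) have the same color. An edge-colored graph is rainbow if no two of its edges have the same color. $K_{m,n}\rightarrow_R K_{a,b}$ means that every proper edge-coloring of $K_{m,n}$ contains at least one rainbow subgraph isomorphic to $K_{a,b}$ (either part of $K_{a,b}$ may lie in either part of $K_{m,n}$). The vertex anti-Ramsey number $AR_V(K_{a,b})$ is the minimum of the number of vertices $m+n$ over all positive integers $m\le n$ with $K_{m,n}\rightarrow_R K_{a,b}$. *)

theory Defs
  imports Main
begin

datatype 'a graph = Graph (verts: "'a set") (edges: "'a set set")

definition simple_graph :: "'a graph \<Rightarrow> bool" where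
  "simple_graph G \<longleftrightarrow> (\<forall>e\<in>edges G. e \<subseteq> verts G \<and> card e = 2)"

definition subgraph :: "'a graph \<Rightarrow> 'a graph \<Rightarrow> bool" where
  "subgraph H G \<longleftrightarrow> simple_graph H \<and> verts H \<subseteq> verts G \<and> edges H \<subseteq> edges G"

definition isomorphic :: "'a graph \<Rightarrow> 'b graph \<Rightarrow> bool" where
  "isomorphic G H \<longleftrightarrow>
     (\<exists>f. bij_betw f (verts G) (verts H) \<and>
          (\<forall>u\<in>verts G. \<forall>v\<in>verts G. {u, v} \<in> edges G \<longleftrightarrow> {f u, f v} \<in> edges H))"

definition complete_bipartite :: "nat \<Rightarrow> nat \<Rightarrow> (nat + nat) graph" where
  "complete_bipartite m n =
     Graph (Inl ` {..<m} \<union> Inr ` {..<n}) {{Inl i, Inr j} | i j. i < m \<and> j < n}"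

definition proper_edge_coloring :: "'a graph \<Rightarrow> ('a set \<Rightarrow> 'c) \<Rightarrow> bool" where
  "proper_edge_coloring G c \<longleftrightarrow>
     (\<forall>e\<in>edges G. \<forall>f\<in>edges G. e \<noteq> f \<and> e \<inter> f \<noteq> {} \<longrightarrow> c e \<noteq> c f)"

definition rainbow :: "'a graph \<Rightarrow> ('a set \<Rightarrow> 'c) \<Rightarrow> bool" where
  "rainbow H c \<longleftrightarrow> inj_on c (edges H)"

text \<open>Colors are natural numbers: the graphs are finite, so this allows any number of colors.
  Isomorphism does not see the bipartition of the host graph, so either part of the small graph may
  lie in either part of the large one.\<close>

definition rainbow_arrow :: "nat \<Rightarrow> nat \<Rightarrow> nat \<Rightarrow> nat \<Rightarrow> bool" where
  "rainbow_arrow m n a b \<longleftrightarrow>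
     (\<forall>c :: (nat + nat) set \<Rightarrow> nat. proper_edge_coloring (complete_bipartite m n) c \<longrightarrow>
        (\<exists>H. subgraph H (complete_bipartite m n) \<and>
             isomorphic H (complete_bipartite a b) \<and> rainbow H c))"

text \<open>On the natural numbers \<open>Inf\<close> of a nonempty set is its minimum, and \<open>Inf {} = 0\<close>. Every element
  of the set below is positive, so a positive value is always an attained minimum.\<close>

definition AR_V :: "nat \<Rightarrow> nat \<Rightarrow> nat" where
  "AR_V a b = Inf {m + n | m n. 1 \<le> m \<and> m \<le> n \<and> rainbow_arrow m n a b}"

end

theory Submission
  imports Defs "HOL-Library.FuncSet"
begin

text \<open>
  Two rows of a properly colored \<open>K\<^bsub>m,n\<^esub>\<close> and a set \<open>S\<close> of columns span a rainbow graph exactly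
  when the colors of the first row on \<open>S\<close> are disjoint from those of the second row on \<open>S\<close>; call two
  columns in conflict if a color of one row in the first column is the color of the other row in
  the second.

  \<^bold>\<open>Upper bound.\<close> In \<open>K\<^bsub>2,3b-2\<^esub>\<close> every column conflicts with at most two others, so a greedy choice,
  which discards at most three columns per step, finds \<open>b\<close> columns without conflict.

  \<^bold>\<open>Lower bound.\<close> Let \<open>m \<le> n\<close> and \<open>m + n \<le> 3b - 1\<close>. If \<open>n < 2b\<close>, the cyclic coloring \<open>(i + j) mod n\<close>
  has fewer than the \<open>2b\<close> colors of a rainbow \<open>K\<^bsub>2,b\<^esub>\<close>. If \<open>n \<ge> 2b\<close>, then \<open>m < b\<close>, so the two vertices
  of the small part of \<open>K\<^bsub>2,b\<^esub>\<close> must be rows, and it is enough to color so that no two rows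
  have \<open>b\<close> columns without conflict. Adding columns, assume \<open>m + n = 3b - 1\<close>. The extremal situation
  for two rows is that the columns fall into conflict triangles. Addition in the group \<open>(\<int>/3)\<^sup>k\<close>
  produces this for all pairs of rows at once: distinct rows \<open>x\<close> and \<open>y\<close> have the same color in
  columns \<open>z + (y - x)\<close> and \<open>z\<close>, respectively, and \<open>y - x\<close> has order three. Choose \<open>k\<close> with
  \<open>3\<^sup>k\<^sup>-\<^sup>1 \<le> m < 3\<^sup>k\<close>. Blocks of \<open>3\<^sup>k\<close> columns, each on colors of its own, contribute at most a third
  of their width (\<open>ternary_block\<close>). They are split off until \<open>r\<close> columns remain with
  \<open>r \<le> 2m + 1\<close> or \<open>r \<le> 3\<^sup>k\<close>. These are colored cyclically with \<open>max m r\<close> colors if \<open>r \<le> 2m + 1\<close>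
  (\<open>sparse_cyclic\<close>), and as a part of a block otherwise. The lemma \<open>sparse_coloring_exists\<close> adds this
  up: it allows \<open>s = (n + m - 2) / 3\<close> columns without conflict, and the term \<open>(m - 2) / 3\<close> pays for
  the columns outside the blocks.
\<close>

section \<open>Complete bipartite subgraphs with a part of size two\<close>

lemma complete_bipartite_edge_iff [simp]:
  "{Inl i, Inr j} \<in> edges (complete_bipartite m n) \<longleftrightarrow> i < m \<and> j < n"
  "{Inr j, Inl i} \<in> edges (complete_bipartite m n) \<longleftrightarrow> i < m \<and> j < n"
  "{Inl i, Inl i'} \<notin> edges (complete_bipartite m n)"
  "{Inr j, Inr j'} \<notin> edges (complete_bipartite m n)"
  by (auto simp: complete_bipartite_def doubleton_eq_iff)

lemma complete_bipartite_verts [simp]: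
  "Inl i \<in> verts (complete_bipartite m n) \<longleftrightarrow> i < m"
  "Inr j \<in> verts (complete_bipartite m n) \<longleftrightarrow> j < n"
  by (auto simp: complete_bipartite_def)

text \<open>
  A connected bipartite graph has only one bipartition, so a copy of \<open>K\<^bsub>2,b\<^esub>\<close> sits in
  \<open>K\<^bsub>m,n\<^esub>\<close> in one of two ways.
\<close>

lemma K2b_copy_cases:
  assumes sub: "subgraph H (complete_bipartite m n)"
    and iso: "isomorphic H (complete_bipartite 2 b)" and b: "b \<ge> 1"
  obtains (rows) i i' S where "i < m" "i' < m" "i \<noteq> i'" "S \<subseteq> {..<n}" "card S = b"
      "\<And>j. j \<in> S \<Longrightarrow> {Inl i, Inr j} \<in> edges H \<and> {Inl i', Inr j} \<in> edges H"
    | (columns) j j' S where "j < n" "j' < n" "j \<noteq> j'" "S \<subseteq> {..<m}" "card S = b"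
      "\<And>i. i \<in> S \<Longrightarrow> {Inl i, Inr j} \<in> edges H \<and> {Inl i, Inr j'} \<in> edges H"
proof -
  from iso obtain f where f: "bij_betw f (verts H) (verts (complete_bipartite 2 b))"
    and fe: "\<And>u v. u \<in> verts H \<Longrightarrow> v \<in> verts H \<Longrightarrow>
      {u, v} \<in> edges H \<longleftrightarrow> {f u, f v} \<in> edges (complete_bipartite 2 b)"
    unfolding isomorphic_def by blast
  define g where "g = inv_into (verts H) f"
  have g: "bij_betw g (verts (complete_bipartite 2 b)) (verts H)"
    unfolding g_def by (rule bij_betw_inv_into[OF f])
  have fg: "f (g x) = x" if "x \<in> verts (complete_bipartite 2 b)" for x
    unfolding g_def by (rule bij_betw_inv_into_right[OF f that])
  have gH: "g x \<in> verts H" if "x \<in> verts (complete_bipartite 2 b)" for x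
    using g that by (rule bij_betw_apply)
  have ginj: "inj_on g (verts (complete_bipartite 2 b))"
    using g by (rule bij_betw_imp_inj_on)
  have e: "{g (Inl k), g (Inr j)} \<in> edges H" if "k < 2" "j < b" for k j
    using that fe[of "g (Inl k)" "g (Inr j)"] gH[of "Inl k"] gH[of "Inr j"]
      fg[of "Inl k"] fg[of "Inr j"] by simp
  have eG: "{g (Inl k), g (Inr j)} \<in> edges (complete_bipartite m n)" if "k < 2" "j < b" for k j
    using e[OF that] sub by (auto simp: subgraph_def)
  have ne: "g (Inl 0) \<noteq> g (Inl 1)"
    using inj_onD[OF ginj, of "Inl 0" "Inl 1"] by auto
  have inj_r: "inj_on (\<lambda>j. g (Inr j)) {..<b}"
    using inj_onD[OF ginj] by (intro inj_onI) fastforce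
  show thesis
  proof (cases "g (Inl 0)")
    case (Inl i)
    have "\<exists>v. g (Inr j) = Inr v" if "j < b" for j
      using eG[of 0 j] that Inl by (cases "g (Inr j)") auto
    then obtain t where t: "\<And>j. j < b \<Longrightarrow> g (Inr j) = Inr (t j)" by metis
    obtain i' where i': "g (Inl 1) = Inl i'"
      using eG[of 1 0] t[of 0] b by (cases "g (Inl 1)") auto
    have "inj_on t {..<b}"
      using inj_r t by (auto simp: inj_on_def)
    then have "card (t ` {..<b}) = b" by (simp add: card_image)
    moreover have "i < m" "i' < m" "t ` {..<b} \<subseteq> {..<n}"
      using eG[of 0] eG[of 1] t Inl i' b by fastforce+
    moreover have "i \<noteq> i'" using ne Inl i' by simp
    moreover have "{Inl i, Inr j} \<in> edges H \<and> {Inl i', Inr j} \<in> edges H" if "j \<in> t ` {..<b}" for j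
      using that e[of 0] e[of 1] t Inl i' by force
    ultimately show thesis by (intro rows)
  next
    case (Inr i)
    have "\<exists>v. g (Inr j) = Inl v" if "j < b" for j
      using eG[of 0 j] that Inr by (cases "g (Inr j)") auto
    then obtain t where t: "\<And>j. j < b \<Longrightarrow> g (Inr j) = Inl (t j)" by metis
    obtain i' where i': "g (Inl 1) = Inr i'"
      using eG[of 1 0] t[of 0] b by (cases "g (Inl 1)") auto
    have "inj_on t {..<b}"
      using inj_r t by (auto simp: inj_on_def)
    then have "card (t ` {..<b}) = b" by (simp add: card_image)
    moreover have "i < n" "i' < n" "t ` {..<b} \<subseteq> {..<m}"
      using eG[of 0] eG[of 1] t Inr i' b by fastforce+
    moreover have "i \<noteq> i'" using ne Inr i' by simp
    moreover have "{Inl j, Inr i} \<in> edges H \<and> {Inl j, Inr i'} \<in> edges H" if "j \<in> t ` {..<b}" for j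
      using that e[of 0] e[of 1] t Inr i' by (force simp: insert_commute)
    ultimately show thesis by (intro columns)
  qed
qed

section \<open>The host graph with two rows\<close>

text \<open>
  A column \<open>x\<close> conflicts with at most one \<open>y\<close> such that \<open>f y = g x\<close> and at most one such that
  \<open>g y = f x\<close>, so choosing \<open>x\<close> costs at most three columns.
\<close>

lemma disjoint_images_greedy:
  assumes "finite A" "inj_on f A" "inj_on g A" "\<And>x. x \<in> A \<Longrightarrow> f x \<noteq> g x"
    and "card A \<ge> 3 * b - 2"
  shows "\<exists>S\<subseteq>A. card S = b \<and> f ` S \<inter> g ` S = {}"
  using assms
proof (induction b arbitrary: A)
  case 0
  show ?case by (rule exI[of _ "{}"]) auto
next
  case (Suc b)
  then have "A \<noteq> {}" by auto
  then obtain x where x: "x \<in> A" by blast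
  define X where "X = {y \<in> A. f y = g x}"
  define Y where "Y = {y \<in> A. g y = f x}"
  define B where "B = A - ({x} \<union> X \<union> Y)"
  have "card X \<le> 1" "card Y \<le> 1"
    using Suc.prems(1-3) by (auto simp: X_def Y_def card_le_Suc0_iff_eq inj_on_def)
  moreover have "card ({x} \<union> X \<union> Y) \<le> card {x} + card X + card Y"
    using card_Un_le[of "{x} \<union> X" Y] card_Un_le[of "{x}" X] by linarith
  ultimately have "card ({x} \<union> X \<union> Y) \<le> 3" by simp
  moreover have "card A - card ({x} \<union> X \<union> Y) \<le> card B"
    unfolding B_def using Suc.prems(1) by (intro diff_card_le_card_Diff) (auto simp: X_def Y_def)
  ultimately have "card B \<ge> 3 * b - 2" using Suc.prems(5) by arith
  moreover have BA: "B \<subseteq> A" by (auto simp: B_def)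
  ultimately obtain S where S: "S \<subseteq> B" "card S = b" "f ` S \<inter> g ` S = {}"
    using Suc.IH[of B] Suc.prems finite_subset inj_on_subset
    by (metis subsetD)
  have "finite S" using S(1) BA Suc.prems(1) by (meson finite_subset)
  moreover have "x \<notin> S" using S(1) by (auto simp: B_def)
  ultimately have "card (insert x S) = Suc b" using S(2) by simp
  moreover have "f x \<noteq> g y \<and> g x \<noteq> f y" if "y \<in> S" for y
    using that S(1) by (auto simp: B_def X_def Y_def)
  then have "f ` insert x S \<inter> g ` insert x S = {}"
    using S(3) Suc.prems(4)[OF x] by auto
  ultimately show ?case using S(1) BA x by (intro exI[of _ "insert x S"]) auto
qed

lemma rainbow_arrow_two_rows:
  "rainbow_arrow 2 (3 * b - 2) 2 b"
  unfolding rainbow_arrow_def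
proof (intro allI impI)
  define n where "n = 3 * b - 2"
  fix c :: "(nat + nat) set \<Rightarrow> nat"
  assume "proper_edge_coloring (complete_bipartite 2 (3 * b - 2)) c"
  then have proper: "\<And>e f. e \<in> edges (complete_bipartite 2 n) \<Longrightarrow>
      f \<in> edges (complete_bipartite 2 n) \<Longrightarrow> e \<inter> f \<noteq> {} \<Longrightarrow> c e = c f \<Longrightarrow> e = f"
    by (auto simp: proper_edge_coloring_def n_def)
  define col where "col k j = c {Inl k, Inr j}" for k j
  have row_inj: "inj_on (col k) {..<n}" if "k < 2" for k
  proof (rule inj_onI)
    fix j j' assume "j \<in> {..<n}" "j' \<in> {..<n}" "col k j = col k j'"
    then show "j = j'"
      using proper[of "{Inl k, Inr j}" "{Inl k, Inr j'}"] that
      by (auto simp: col_def doubleton_eq_iff)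
  qed
  have "col 0 j \<noteq> col 1 j" if "j \<in> {..<n}" for j
    using proper[of "{Inl 0, Inr j}" "{Inl 1, Inr j}"] that
    by (auto simp: col_def doubleton_eq_iff)
  then obtain S where S: "S \<subseteq> {..<n}" "card S = b" "col 0 ` S \<inter> col 1 ` S = {}"
    using disjoint_images_greedy[of "{..<n}" "col 0" "col 1" b] row_inj[of 0] row_inj[of 1]
    by (auto simp: n_def)
  have "finite S" using S(1) finite_subset by blast
  then obtain h where h: "bij_betw h S {..<b}"
    using S(2) ex_bij_betw_finite_nat[of S] by (auto simp: atLeast0LessThan)
  define H where "H = Graph (Inl ` {..<2::nat} \<union> Inr ` S) {{Inl i, Inr j} | i j. i < (2::nat) \<and> j \<in> S}"
  have "subgraph H (complete_bipartite 2 n)"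
    using S(1) unfolding subgraph_def simple_graph_def H_def complete_bipartite_def by auto
  moreover have "isomorphic H (complete_bipartite 2 b)"
    unfolding isomorphic_def
  proof (intro exI conjI ballI)
    have hb: "h j < b" if "j \<in> S" for j using bij_betw_apply[OF h that] by simp
    have "inj_on (map_sum id h) (verts H)"
      using bij_betw_imp_inj_on[OF h] by (auto simp: H_def intro!: inj_onI dest: inj_onD)
    moreover have "map_sum id h ` verts H = Inl ` {..<2} \<union> Inr ` h ` S"
      by (simp add: H_def image_Un image_image)
    then have "map_sum id h ` verts H = verts (complete_bipartite 2 b)"
      using bij_betw_imp_surj_on[OF h] by (simp add: complete_bipartite_def)
    ultimately show "bij_betw (map_sum id h) (verts H) (verts (complete_bipartite 2 b))"
      by (simp add: bij_betw_def)
    fix u v assume "u \<in> verts H" "v \<in> verts H"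
    then show "{u, v} \<in> edges H \<longleftrightarrow> {map_sum id h u, map_sum id h v} \<in> edges (complete_bipartite 2 b)"
      using hb by (auto simp: H_def doubleton_eq_iff)
  qed
  moreover have "rainbow H c"
    unfolding rainbow_def
  proof (rule inj_onI)
    fix e f assume "e \<in> edges H" "f \<in> edges H" and eq: "c e = c f"
    then obtain i j i' j' where ij: "e = {Inl i, Inr j}" "f = {Inl i', Inr j'}"
      "i < 2" "i' < 2" "j \<in> S" "j' \<in> S"
      by (auto simp: H_def)
    have "i = i'"
    proof (rule ccontr)
      assume "i \<noteq> i'"
      then have "(i = 0 \<and> i' = 1) \<or> (i = 1 \<and> i' = 0)" using ij by auto
      then have "c e \<in> col 0 ` S \<inter> col 1 ` S \<or> c f \<in> col 0 ` S \<inter> col 1 ` S"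
        using ij eq unfolding col_def by (metis (no_types, lifting) IntI image_eqI)
      then show False using S(3) by blast
    qed
    moreover from this have "j = j'"
      using inj_onD[OF row_inj[of i], of j j'] ij eq S(1) by (auto simp: col_def)
    ultimately show "e = f" using ij by simp
  qed
  ultimately show "\<exists>H. subgraph H (complete_bipartite 2 (3 * b - 2)) \<and>
      isomorphic H (complete_bipartite 2 b) \<and> rainbow H c"
    unfolding n_def by blast
qed

section \<open>Colorings in which any two rows share many colors\<close>

definition latin :: "nat \<Rightarrow> nat \<Rightarrow> (nat \<Rightarrow> nat \<Rightarrow> nat) \<Rightarrow> bool" where
  "latin m n c \<longleftrightarrow> (\<forall>i<m. inj_on (c i) {..<n}) \<and> (\<forall>j<n. inj_on (\<lambda>i. c i j) {..<m})"

text \<open>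
  For a Latin rectangle, this says that a rainbow graph on two rows has at most \<open>s\<close> columns.
\<close>

definition sparse :: "nat \<Rightarrow> nat \<Rightarrow> nat \<Rightarrow> (nat \<Rightarrow> nat \<Rightarrow> nat) \<Rightarrow> bool" where
  "sparse m n s c \<longleftrightarrow> (\<forall>i<m. \<forall>i'<m. \<forall>S\<subseteq>{..<n}. i \<noteq> i' \<and> c i ` S \<inter> c i' ` S = {} \<longrightarrow> card S \<le> s)"

lemma latin_mono: "latin m' n' c \<Longrightarrow> m \<le> m' \<Longrightarrow> n \<le> n' \<Longrightarrow> latin m n c"
  unfolding latin_def by (meson inj_on_subset lessThan_subset_iff order_less_le_trans)

lemma sparse_mono: "sparse m' n' s' c \<Longrightarrow> m \<le> m' \<Longrightarrow> n \<le> n' \<Longrightarrow> s' \<le> s \<Longrightarrow> sparse m n s c"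
  unfolding sparse_def
  by (smt (verit, best) lessThan_subset_iff order_less_le_trans order_trans)

lemma add_mod_cancel_nat:
  fixes i j j' N :: nat
  assumes "(i + j) mod N = (i + j') mod N" "j < N" "j' < N"
  shows "j = j'"
proof -
  have "int (i + j) mod int N = int (i + j') mod int N"
    using assms(1) by (metis zmod_int)
  then have "int j mod int N = int j' mod int N"
    by (metis add_diff_cancel_left' mod_diff_left_eq of_nat_add)
  then show ?thesis using assms(2,3) by simp
qed

lemma latin_cyclic:
  assumes "m \<le> N" "n \<le> N"
  shows "latin m n (\<lambda>i j. (i + j) mod N)"
proof -
  have "j = j'" if "(i + j) mod N = (i + j') mod N" "j < n" "j' < n" for i j j'
    using add_mod_cancel_nat[OF that(1)] that assms by linarith
  moreover have "i = i'" if "(i + j) mod N = (i' + j) mod N" "i < m" "i' < m" for i i' j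
    using add_mod_cancel_nat[of j i N i'] that assms by (simp add: add.commute)
  ultimately show ?thesis unfolding latin_def inj_on_def by blast
qed

lemma disjoint_images_card_le:
  assumes "inj_on f S" "inj_on g S" "f ` S \<inter> g ` S = {}" "f ` S \<union> g ` S \<subseteq> {..<N::nat}"
  shows "2 * card S \<le> N"
proof -
  have "finite (f ` S)" "finite (g ` S)" using assms(4) finite_subset by blast+
  then have "card (f ` S \<union> g ` S) = card S + card S"
    using assms(1-3) by (simp add: card_Un_disjoint card_image)
  then show ?thesis using card_mono[OF _ assms(4)] by simp
qed

lemma cyclic_disjoint_card_le:
  assumes "S \<subseteq> {..<N::nat}"
    and "(\<lambda>j. (i + j) mod N) ` S \<inter> (\<lambda>j. (i' + j) mod N) ` S = {}"
  shows "2 * card S \<le> N"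
proof (rule disjoint_images_card_le[OF _ _ assms(2)])
  show "inj_on (\<lambda>j. (i + j) mod N) S" "inj_on (\<lambda>j. (i' + j) mod N) S"
    using assms(1) by (auto intro!: inj_onI dest: add_mod_cancel_nat)
  show "(\<lambda>j. (i + j) mod N) ` S \<union> (\<lambda>j. (i' + j) mod N) ` S \<subseteq> {..<N}"
    using assms(1) by (force intro!: mod_less_divisor)
qed

lemma mod3_difference:
  fixes a b d u v :: int
  assumes "(a + u * d) mod 3 = (b + v * d) mod 3" "(u, v) \<in> {(0, 1), (1, 2), (2, 0)}"
  shows "(a - b - d) mod 3 = 0"
proof -
  have *: "3 dvd a + u * d - (b + v * d)" using assms(1) by (simp add: mod_eq_dvd_iff)
  from assms(2) consider "u = 0" "v = 1" | "u = 1" "v = 2" | "u = 2" "v = 0" by auto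
  then show ?thesis
  proof cases
    case 1
    with * have "3 dvd a - (b + d)" by simp
    then show ?thesis by presburger
  next
    case 2
    with * have "3 dvd a + d - (b + 2 * d)" by simp
    then show ?thesis by presburger
  next
    case 3
    with * have "3 dvd a + 2 * d - b" by simp
    then show ?thesis by presburger
  qed
qed

text \<open>
  The Cayley table of \<open>(\<int>/3)\<^sup>k\<close>. If the colors of rows \<open>x\<close> and \<open>y\<close> are disjoint on a set \<open>T\<close> of columns,
  then no two elements of \<open>T\<close> differ by \<open>y - x\<close>; as \<open>3 (y - x) = 0\<close>, the translates of \<open>T\<close> by
  \<open>0\<close>, \<open>y - x\<close> and \<open>2 (y - x)\<close> are disjoint, so \<open>T\<close> fills at most a third of the group.
\<close>

lemma ternary_block:
  "\<exists>c. latin (3 ^ Suc p) (3 ^ Suc p) c \<and> sparse (3 ^ Suc p) (3 ^ Suc p) (3 ^ p) c"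
proof -
  define I where "I = {..<Suc p}"
  define G :: "(nat \<Rightarrow> int) set" where "G = I \<rightarrow>\<^sub>E {0, 1, 2}"
  define K :: nat where "K = 3 ^ Suc p"
  define red where "red z = restrict (\<lambda>i. z i mod 3) I" for z :: "nat \<Rightarrow> int"
  have finG: "finite G" by (simp add: G_def I_def finite_PiE)
  have cardG: "card G = K" by (simp add: G_def I_def K_def card_PiE numeral_3_eq_3)
  have redG: "red z \<in> G" for z
    by (auto simp: red_def G_def)
  have red_eq: "red z = red w \<longleftrightarrow> (\<forall>i\<in>I. z i mod 3 = w i mod 3)" for z w
    by (auto simp: red_def fun_eq_iff restrict_def)
  have G_eqI: "z = w" if "z \<in> G" "w \<in> G" "\<forall>i\<in>I. z i mod 3 = w i mod 3" for z w
  proof -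
    have "z i = w i" if "i \<in> I" for i
    proof -
      have "z i \<in> {0, 1, 2}" "w i \<in> {0, 1, 2}"
        using \<open>z \<in> G\<close> \<open>w \<in> G\<close> that by (auto simp: G_def PiE_def Pi_def)
      then show ?thesis using \<open>\<forall>i\<in>I. z i mod 3 = w i mod 3\<close> that by fastforce
    qed
    then show ?thesis by (rule PiE_ext[OF that(1,2)[unfolded G_def]])
  qed
  obtain e where e: "bij_betw e G {..<K}"
    using ex_bij_betw_finite_nat[OF finG] cardG by (auto simp: atLeast0LessThan)
  define h where "h = inv_into G e"
  have h: "bij_betw h {..<K} G" unfolding h_def using e by (rule bij_betw_inv_into)
  have hG: "h i \<in> G" if "i < K" for i using bij_betw_apply[OF h] that by simp
  have h_eqD: "i = j" if "h i = h j" "i < K" "j < K" for i j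
    using inj_onD[OF bij_betw_imp_inj_on[OF h]] that by simp
  define c where "c i j = e (red (\<lambda>k. h i k + h j k))" for i j
  have c_eq: "c i j = c i' j' \<longleftrightarrow> (\<forall>k\<in>I. (h i k + h j k) mod 3 = (h i' k + h j' k) mod 3)" for i j i' j'
    unfolding c_def red_eq[symmetric]
    using inj_on_eq_iff[OF bij_betw_imp_inj_on[OF e] redG redG] by simp
  have row: "j = j'" if "c i j = c i j'" "j < K" "j' < K" for i j j'
  proof -
    have "h j k mod 3 = h j' k mod 3" if "k \<in> I" for k
      using \<open>c i j = c i j'\<close> that unfolding c_eq by (simp add: mod_eq_dvd_iff)
    then show ?thesis using G_eqI[OF hG hG] h_eqD that(2,3) by blast
  qed
  have c_commute: "c i j = c j i" for i j by (simp add: c_eq add.commute)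
  have "latin K K c"
    unfolding latin_def inj_on_def using row c_commute by (metis lessThan_iff)
  moreover have "sparse K K (3 ^ p) c"
    unfolding sparse_def
  proof (intro allI impI, elim conjE)
    fix i i' S assume "i < K" "i' < K" and S: "S \<subseteq> {..<K}" and disj: "c i ` S \<inter> c i' ` S = {}"
    define \<tau> where "\<tau> = (\<lambda>(u::int, j). red (\<lambda>k. h j k + u * (h i' k - h i k)))"
    have no: False if "j \<in> S" "j' \<in> S"
      and "\<forall>k\<in>I. (h j k - h j' k - (h i' k - h i k)) mod 3 = 0" for j j'
    proof -
      have "(h i k + h j k) mod 3 = (h i' k + h j' k) mod 3" if "k \<in> I" for k
        using \<open>\<forall>k\<in>I. (h j k - h j' k - (h i' k - h i k)) mod 3 = 0\<close> that
        by (simp add: mod_eq_dvd_iff mod_eq_0_iff_dvd algebra_simps)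
      then have "c i j = c i' j'" by (simp add: c_eq)
      then show False using disj that(1,2) by blast
    qed
    have "inj_on \<tau> ({0, 1, 2} \<times> S)"
    proof (rule inj_onI, clarify)
      fix u v :: int and j j'
      assume u: "u \<in> {0, 1, 2}" and v: "v \<in> {0, 1, 2}" and j: "j \<in> S" "j' \<in> S"
        and "\<tau> (u, j) = \<tau> (v, j')"
      then have eq: "\<forall>k\<in>I. (h j k + u * (h i' k - h i k)) mod 3 = (h j' k + v * (h i' k - h i k)) mod 3"
        by (simp add: \<tau>_def red_eq)
      have "u = v"
      proof (rule ccontr)
        assume "u \<noteq> v"
        \<comment> \<open>Modulo three, one of \<open>v - u\<close> and \<open>u - v\<close> is \<open>1\<close>, so two elements of \<open>S\<close> differ by one step.\<close>
        then consider "(u, v) \<in> {(0, 1), (1, 2), (2, 0)}" | "(u, v) \<in> {(1, 0), (2, 1), (0, 2)}"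
          using u v by auto
        then show False
        proof cases
          case 1
          then have "(h j k - h j' k - (h i' k - h i k)) mod 3 = 0" if "k \<in> I" for k
            using mod3_difference[OF bspec[OF eq that]] by blast
          then show False using no j by blast
        next
          case 2
          then have "(v, u) \<in> {(0, 1), (1, 2), (2, 0)}" by auto
          then have "(h j' k - h j k - (h i' k - h i k)) mod 3 = 0" if "k \<in> I" for k
            using mod3_difference[OF bspec[OF eq that, symmetric]] by blast
          then show False using no j by blast
        qed
      qed
      moreover have "j = j'"
      proof -
        have "h j k mod 3 = h j' k mod 3" if "k \<in> I" for k
          using bspec[OF eq that] \<open>u = v\<close> by (simp add: mod_eq_dvd_iff)
        then show ?thesis using G_eqI[OF hG hG] h_eqD j S by blast
      qed
      ultimately show "u = v \<and> j = j'" by simp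
    qed
    moreover have "\<tau> ` ({0, 1, 2} \<times> S) \<subseteq> G" using redG by (auto simp: \<tau>_def)
    ultimately have "card ({0, 1, 2::int} \<times> S) \<le> K"
      using card_inj_on_le finG cardG by metis
    then show "card S \<le> 3 ^ p" by (simp add: card_cartesian_product K_def)
  qed
  ultimately show ?thesis unfolding K_def by blast
qed

text \<open>
  Two colorings are placed side by side, one on even and one on odd colors. As they share no
  color, columns of different parts may well be free of conflict, and the bounds add.
\<close>

lemma sparse_juxtapose:
  assumes "latin m n1 c1" "sparse m n1 s1 c1" "latin m n2 c2" "sparse m n2 s2 c2"
  shows "\<exists>c. latin m (n1 + n2) c \<and> sparse m (n1 + n2) (s1 + s2) c"
proof -
  define c where "c i j = (if j < n1 then 2 * c1 i j else Suc (2 * c2 i (j - n1)))" for i j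
  have parity: "2 * a \<noteq> Suc (2 * b)" "Suc (2 * b) \<noteq> 2 * a" for a b :: nat by presburger+
  have row: "j = j'" if "c i j = c i j'" "i < m" "j < n1 + n2" "j' < n1 + n2" for i j j'
  proof (cases "j < n1"; cases "j' < n1")
    assume "j < n1" "j' < n1"
    then show ?thesis using that assms(1) by (auto simp: c_def latin_def inj_on_def)
  next
    assume *: "\<not> j < n1" "\<not> j' < n1"
    then have "j - n1 = j' - n1"
      using that assms(3) unfolding latin_def inj_on_def
      by (auto simp: c_def)
    then show ?thesis using * by linarith
  qed (use that parity in \<open>auto simp: c_def\<close>)
  have column: "i = i'" if "c i j = c i' j" "j < n1 + n2" "i < m" "i' < m" for i i' j
  proof -
    have "c1 i j = c1 i' j \<and> j < n1 \<or> c2 i (j - n1) = c2 i' (j - n1) \<and> j - n1 < n2"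
      using that by (auto simp: c_def split: if_splits)
    then show ?thesis
      using that(3,4) assms(1,3) unfolding latin_def inj_on_def by blast
  qed
  have "latin m (n1 + n2) c"
    unfolding latin_def by (auto intro!: inj_onI dest: row column)
  moreover have "sparse m (n1 + n2) (s1 + s2) c"
    unfolding sparse_def
  proof (intro allI impI, elim conjE)
    fix i i' S
    assume i: "i < m" "i' < m" "i \<noteq> i'" and S: "S \<subseteq> {..<n1 + n2}" and disj: "c i ` S \<inter> c i' ` S = {}"
    define A where "A = S \<inter> {..<n1}"
    define B where "B = {j. j + n1 \<in> S}"
    have "S = A \<union> (\<lambda>j. j + n1) ` B"
    proof -
      have "x \<in> (\<lambda>j. j + n1) ` B" if "x \<in> S" "\<not> x < n1" for x
        using that by (intro image_eqI[of _ _ "x - n1"]) (auto simp: B_def)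
      then show ?thesis by (auto simp: A_def B_def)
    qed
    then have "card S \<le> card A + card ((\<lambda>j. j + n1) ` B)" using card_Un_le by metis
    also have "card ((\<lambda>j. j + n1) ` B) = card B" by (simp add: card_image)
    finally have cardS: "card S \<le> card A + card B" .
    have "c1 i x \<noteq> c1 i' y" if "x \<in> A" "y \<in> A" for x y
    proof -
      have "c i x \<noteq> c i' y" using disj that by (auto simp: A_def)
      then show ?thesis using that by (auto simp: c_def A_def)
    qed
    then have "c1 i ` A \<inter> c1 i' ` A = {}" by auto
    then have cardA: "card A \<le> s1" using assms(2) i by (auto simp: sparse_def A_def)
    have "c2 i x \<noteq> c2 i' y" if "x \<in> B" "y \<in> B" for x y
    proof -
      have "c i (x + n1) \<noteq> c i' (y + n1)" using disj that by (auto simp: B_def)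
      then show ?thesis by (auto simp: c_def)
    qed
    then have "c2 i ` B \<inter> c2 i' ` B = {}" by auto
    moreover have "B \<subseteq> {..<n2}" using S by (auto simp: B_def)
    ultimately have "card B \<le> s2" using assms(4) i unfolding sparse_def by blast
    with cardA cardS show "card S \<le> s1 + s2" by linarith
  qed
  ultimately show ?thesis by blast
qed

text \<open>
  If \<open>S\<close> is a set of columns on which two rows have disjoint colors, the cyclic coloring gives
  \<open>card S \<le> n\<close> and \<open>2 card S \<le> max m n\<close>. If \<open>n < m\<close>, adding these yields \<open>3 card S \<le> n + m\<close>;
  if \<open>m \<le> n \<le> 2m + 1\<close>, the second one gives \<open>6 card S \<le> 3n \<le> 2 (n + m) + 1\<close>.
  Both imply \<open>card S \<le> s\<close>.
\<close>

lemma sparse_cyclic: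
  assumes "n + m = 3 * s + 2" "n \<le> 2 * m + 1"
  shows "sparse m n s (\<lambda>i j. (i + j) mod max m n)"
  unfolding sparse_def
proof (intro allI impI, elim conjE)
  fix i i' S
  assume S: "S \<subseteq> {..<n}"
    and "(\<lambda>j. (i + j) mod max m n) ` S \<inter> (\<lambda>j. (i' + j) mod max m n) ` S = {}"
  moreover from S have "S \<subseteq> {..<max m n}" by auto
  ultimately have "2 * card S \<le> max m n" using cyclic_disjoint_card_le by blast
  moreover have "card S \<le> n" using card_mono[OF _ S] by simp
  ultimately show "card S \<le> s" using assms by linarith
qed

text \<open>
  Between \<open>2m + 2\<close> columns and the width \<open>3 * 3\<^sup>p\<close> of a block, part of a block is good enough,
  because \<open>3\<^sup>p \<le> m \<le> s\<close>. More columns than that are reduced by a full block, which costs \<open>3\<^sup>p\<close>, exactly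
  the amount by which \<open>s\<close> decreases with \<open>n\<close>.
\<close>

lemma sparse_coloring_exists:
  assumes "m \<ge> 1" "n + m = 3 * s + 2"
  shows "\<exists>c. latin m n c \<and> sparse m n s c"
proof -
  obtain p where p: "3 ^ p \<le> m" "m < 3 ^ Suc p"
    using ex_power_ivl1[of 3 m] assms(1) by auto
  obtain d where d: "latin (3 ^ Suc p) (3 ^ Suc p) d" "sparse (3 ^ Suc p) (3 ^ Suc p) (3 ^ p) d"
    using ternary_block by blast
  from assms(2) show ?thesis
  proof (induction n arbitrary: s rule: less_induct)
    case (less n)
    consider "n \<le> 2 * m + 1" | "n > 2 * m + 1" "n \<le> 3 ^ Suc p" | "n > 3 ^ Suc p" by linarith
    then show ?case
    proof cases
      case 1
      then show ?thesis using sparse_cyclic less.prems latin_cyclic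
        by (meson max.cobounded1 max.cobounded2)
    next
      case 2
      then have "3 ^ p \<le> s" using p less.prems by linarith
      then show ?thesis
        using latin_mono[OF d(1)] sparse_mono[OF d(2)] p(2) 2(2) by (meson less_imp_le)
    next
      case 3
      then have "3 ^ p \<le> s" using less.prems by simp
      then have "n - 3 ^ Suc p + m = 3 * (s - 3 ^ p) + 2"
        using 3 less.prems by simp
      then obtain c where c: "latin m (n - 3 ^ Suc p) c" "sparse m (n - 3 ^ Suc p) (s - 3 ^ p) c"
        using less.IH[of "n - 3 ^ Suc p" "s - 3 ^ p"] 3 by auto
      have "latin m (3 ^ Suc p) d" "sparse m (3 ^ Suc p) (3 ^ p) d"
        using latin_mono[OF d(1)] sparse_mono[OF d(2)] p(2) by simp_all
      from sparse_juxtapose[OF c this] show ?thesis using 3 \<open>3 ^ p \<le> s\<close>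
        by simp
    qed
  qed
qed

section \<open>From Latin rectangles to edge colorings\<close>

definition edge_coloring :: "(nat \<Rightarrow> nat \<Rightarrow> nat) \<Rightarrow> (nat + nat) set \<Rightarrow> nat" where
  "edge_coloring c e = c (THE i. Inl i \<in> e) (THE j. Inr j \<in> e)"

lemma edge_coloring_edge [simp]: "edge_coloring c {Inl i, Inr j} = c i j"
  by (simp add: edge_coloring_def)

lemma proper_edge_coloring_latin:
  assumes "latin m n c"
  shows "proper_edge_coloring (complete_bipartite m n) (edge_coloring c)"
  unfolding proper_edge_coloring_def
proof (intro ballI impI)
  fix e f assume "e \<in> edges (complete_bipartite m n)" "f \<in> edges (complete_bipartite m n)"
    and *: "e \<noteq> f \<and> e \<inter> f \<noteq> {}"
  then obtain i j i' j' where ij: "e = {Inl i, Inr j}" "f = {Inl i', Inr j'}"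
    "i < m" "i' < m" "j < n" "j' < n"
    by (auto simp: complete_bipartite_def)
  with * consider "i = i'" "j \<noteq> j'" | "i \<noteq> i'" "j = j'" by auto
  then show "edge_coloring c e \<noteq> edge_coloring c f"
    using assms ij by cases (auto simp: latin_def inj_on_def)
qed

lemma not_rainbow_arrow_latin:
  assumes "latin m n c" "b \<ge> 1"
    and rows: "\<And>i i' S. i < m \<Longrightarrow> i' < m \<Longrightarrow> i \<noteq> i' \<Longrightarrow> S \<subseteq> {..<n} \<Longrightarrow>
      c i ` S \<inter> c i' ` S = {} \<Longrightarrow> card S < b"
    and columns: "\<And>j j' S. j < n \<Longrightarrow> j' < n \<Longrightarrow> j \<noteq> j' \<Longrightarrow> S \<subseteq> {..<m} \<Longrightarrow>
      (\<lambda>i. c i j) ` S \<inter> (\<lambda>i. c i j') ` S = {} \<Longrightarrow> card S < b"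
  shows "\<not> rainbow_arrow m n 2 b"
proof
  assume "rainbow_arrow m n 2 b"
  then obtain H where H: "subgraph H (complete_bipartite m n)"
    "isomorphic H (complete_bipartite 2 b)" "rainbow H (edge_coloring c)"
    using proper_edge_coloring_latin[OF assms(1)] by (auto simp: rainbow_arrow_def)
  have rb: "i = i' \<and> j = j'"
    if "{Inl i, Inr j} \<in> edges H" "{Inl i', Inr j'} \<in> edges H" "c i j = c i' j'" for i j i' j'
    using inj_onD[OF H(3)[unfolded rainbow_def] _ that(1,2)] that(3) by (auto simp: doubleton_eq_iff)
  from H(1,2) assms(2) show False
  proof (cases rule: K2b_copy_cases)
    case (rows i i' S)
    have "c i ` S \<inter> c i' ` S = {}" using rows(3,6) rb by blast
    then show False using assms(3) rows(1-5) by blast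
  next
    case (columns j j' S)
    have "(\<lambda>i. c i j) ` S \<inter> (\<lambda>i. c i j') ` S = {}" using columns(3,6) rb by blast
    then show False using assms(4) columns(1-5) by blast
  qed
qed

lemma not_rainbow_arrow_small:
  assumes "1 \<le> m" "m \<le> n" "m + n < 3 * b"
  shows "\<not> rainbow_arrow m n 2 b"
proof (cases "n < 2 * b")
  case True
  show ?thesis
  proof (rule not_rainbow_arrow_latin)
    show "latin m n (\<lambda>i j. (i + j) mod n)" using assms(2) by (intro latin_cyclic) auto
    show "1 \<le> b" using assms by linarith
  next
    fix i i' S
    assume "S \<subseteq> {..<n}" "(\<lambda>j. (i + j) mod n) ` S \<inter> (\<lambda>j. (i' + j) mod n) ` S = {}"
    then show "card S < b" using cyclic_disjoint_card_le[of S n i i'] True by linarith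
  next
    fix j j' S
    assume "S \<subseteq> {..<m}" "(\<lambda>i. (i + j) mod n) ` S \<inter> (\<lambda>i. (i + j') mod n) ` S = {}"
    moreover from this(1) have "S \<subseteq> {..<n}" using assms(2) by auto
    ultimately show "card S < b"
      using cyclic_disjoint_card_le[of S n j j'] True by (simp add: add.commute)
  qed
next
  case False
  \<comment> \<open>Columns are added until \<open>m + n' = 3b - 1\<close>, which makes \<open>s = b - 1\<close>.\<close>
  define n' where "n' = 3 * b - 1 - m"
  have n': "n \<le> n'" "n' + m = 3 * (b - 1) + 2" using assms by (auto simp: n'_def)
  then obtain c where "latin m n' c" "sparse m n' (b - 1) c"
    using sparse_coloring_exists assms(1) by blast
  then have c: "latin m n c" "sparse m n (b - 1) c"
    using latin_mono sparse_mono n'(1) by blast+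
  show ?thesis
  proof (rule not_rainbow_arrow_latin[OF c(1)])
    show "1 \<le> b" using assms by linarith
  next
    fix i i' S
    assume "i < m" "i' < m" "i \<noteq> i'" "S \<subseteq> {..<n}" "c i ` S \<inter> c i' ` S = {}"
    then have "card S \<le> b - 1" using c(2) by (auto simp: sparse_def)
    then show "card S < b" using assms by linarith
  next
    fix S :: "nat set" assume "S \<subseteq> {..<m}"
    then have "card S \<le> m" using card_mono[of "{..<m}" S] by simp
    then show "card S < b" using False assms by linarith
  qed
qed

section \<open>The vertex anti-Ramsey number\<close>

theorem theorem3p2:
  fixes b :: nat
  assumes "b \<ge> 2"
  shows "AR_V 2 b = 3 * b"
  unfolding AR_V_def
proof (rule cInf_eq_minimum)
  have "3 * b = 2 + (3 * b - 2)" "1 \<le> (2::nat)" "2 \<le> 3 * b - 2" using assms by auto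
  then show "3 * b \<in> {m + n | m n. 1 \<le> m \<and> m \<le> n \<and> rainbow_arrow m n 2 b}"
    using rainbow_arrow_two_rows by blast
next
  fix x assume "x \<in> {m + n | m n. 1 \<le> m \<and> m \<le> n \<and> rainbow_arrow m n 2 b}"
  then show "3 * b \<le> x" using not_rainbow_arrow_small by (auto simp: not_less[symmetric])
qed

end
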